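(* Let $X$ be a real Banach space. Gâteaux differentiability and limited differentiability coincide for continuous convex functions on $X$; that is, for every continuous convex function $f:X\to\mathbb{R}$ and every $x\in X$, $f$ is Gâteaux differentiable at $x$ if and only if $f$ is limited differentiable at $x$.
   Context: A bounded set $A\subset X$ is limited if for every weak$^*$-null sequence $(x_n^* )_n\subset X^*$ one has $\lim_{n}\sup_{x\in A}|\langle x_n^*,x\rangle|=0$. For a family $\beta$ of bounded nonempty subsets of $X$, a function $f:X\to\mathbb{R}$ is $\beta$-differentiable at $x_0\in X$ if there is a bounded linear functional $d_\beta f(x_0):X\to\mathbb{R}$ such that $\lim_{t\to 0}\sup_{u\in A}\left|\frac{f(x_0+tu)-f(x_0)}{t}-d_\beta f(x_0)(u)\right|=0$ for every $A\in\beta$. Gâteaux and limited differentiability are $\beta$-differentiability for $\beta$ the family of all nonempty finite sets and of all nonempty limited sets, respectively. *)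

theory Defs
  imports "HOL-Analysis.Analysis"
begin

definition weak_star_null :: "(nat \<Rightarrow> ('a::real_normed_vector \<Rightarrow>\<^sub>L real)) \<Rightarrow> bool" where
  "weak_star_null \<phi> \<longleftrightarrow> (\<forall>x. (\<lambda>n. blinfun_apply (\<phi> n) x) \<longlonglongrightarrow> 0)"

text \<open>
  Suprema of absolute values are taken in the extended nonnegative reals, because the supremum
  of an unbounded set of reals is an unspecified real number. The supremum over the empty set
  is 0 there, so the empty set counts as limited; it is excluded from the family of limited
  sets used for differentiability.
\<close>

definition limited :: "'a::real_normed_vector set \<Rightarrow> bool" where
  "limited A \<longleftrightarrow> bounded A \<and>
     (\<forall>\<phi> :: nat \<Rightarrow> ('a \<Rightarrow>\<^sub>L real). weak_star_null \<phi> \<longrightarrow>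
        (\<lambda>n. SUP x\<in>A. ennreal \<bar>blinfun_apply (\<phi> n) x\<bar>) \<longlonglongrightarrow> 0)"

text \<open>The family \<open>\<beta>\<close> is meant to consist of bounded nonempty sets.\<close>

definition has_beta_derivative ::
    "'a::real_normed_vector set set \<Rightarrow> ('a \<Rightarrow> real) \<Rightarrow> ('a \<Rightarrow>\<^sub>L real) \<Rightarrow> 'a \<Rightarrow> bool" where
  "has_beta_derivative \<beta> f D x0 \<longleftrightarrow>
     (\<forall>A\<in>\<beta>. ((\<lambda>t::real. SUP u\<in>A.
        ennreal \<bar>(f (x0 + t *\<^sub>R u) - f x0) / t - blinfun_apply D u\<bar>) \<longlongrightarrow> 0) (at 0))"

definition beta_differentiable ::
    "'a::real_normed_vector set set \<Rightarrow> ('a \<Rightarrow> real) \<Rightarrow> 'a \<Rightarrow> bool" where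
  "beta_differentiable \<beta> f x0 \<longleftrightarrow> (\<exists>D. has_beta_derivative \<beta> f D x0)"

definition gateaux_differentiable :: "('a::real_normed_vector \<Rightarrow> real) \<Rightarrow> 'a \<Rightarrow> bool" where
  "gateaux_differentiable = beta_differentiable {A. finite A \<and> A \<noteq> {}}"

definition limited_differentiable :: "('a::real_normed_vector \<Rightarrow> real) \<Rightarrow> 'a \<Rightarrow> bool" where
  "limited_differentiable = beta_differentiable {A. limited A \<and> A \<noteq> {}}"

end

theory Submission
  imports Defs
begin

text \<open>
  Let \<open>D\<close> be the Gateaux derivative of \<open>f\<close> at \<open>x\<close>, let \<open>t\<^sub>n \<rightarrow> 0\<close>, and let \<open>u\<^sub>n\<close> range over a limited
  set. If \<open>p\<^sub>n\<close> is a subgradient of \<open>f\<close> at \<open>x + t\<^sub>n u\<^sub>n\<close>, the error of the difference quotient in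
  direction \<open>u\<^sub>n\<close> is at most \<open>\<bar>(p\<^sub>n - D) u\<^sub>n\<bar>\<close>, and \<open>p\<^sub>n - D\<close> is weak-star null because \<open>D\<close> is the only
  subgradient at \<open>x\<close>. Limitedness makes the error vanish uniformly. Subgradients exist since a
  minimal convex minorant vanishing at \<open>0\<close> of \<open>h \<mapsto> f (y + h) - f y\<close> is linear.
\<close>

section \<open>Continuous subgradients of convex functions, by way of minimal convex
  minorants\<close>

lemma convex_on_midpoint_ge:
  fixes g :: "'a::real_vector \<Rightarrow> real"
  assumes "convex_on UNIV g" "g 0 = 0"
  shows "- g (- x) \<le> g x"
proof -
  have "g ((1 - 1/2) *\<^sub>R x + (1/2) *\<^sub>R (- x)) \<le> (1 - 1/2) * g x + (1/2) * g (- x)"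
    using assms(1) by (intro convex_onD) auto
  then show ?thesis using assms(2) by simp
qed

text \<open>Zorn's lemma, with pointwise infima as lower bounds of chains. These infima are finite
  because every admissible \<open>g\<close> satisfies \<open>- g0 (- x) \<le> g x\<close>: midpoint
  convexity turns the upper bound at \<open>- x\<close> into a lower bound at
  \<open>x\<close>.\<close>

lemma convex_on_minimal_minorant:
  fixes g0 :: "'a::real_vector \<Rightarrow> real"
  assumes g0: "convex_on UNIV g0" "g0 0 = 0"
  obtains g where "convex_on UNIV g" "g 0 = 0" "g \<le> g0"
    "\<And>h. convex_on UNIV h \<Longrightarrow> h 0 = 0 \<Longrightarrow> h \<le> g \<Longrightarrow> h = g"
proof -
  define A where "A = {g. convex_on UNIV g \<and> g 0 = 0 \<and> g \<le> g0}"
  \<comment> \<open>The order is reversed, so that the maximal element supplied by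
    \<open>predicate_Zorn\<close> is a pointwise minimal function.\<close>
  define P where "P = (\<lambda>(a::'a \<Rightarrow> real) b. b \<le> a)"
  have lower: "- g0 (- x) \<le> g x" if "g \<in> A" for g x
  proof -
    have "g (- x) \<le> g0 (- x)" using that by (auto simp: A_def le_fun_def)
    then show ?thesis using convex_on_midpoint_ge[of g x] that by (simp add: A_def)
  qed
  have "\<exists>m\<in>A. \<forall>a\<in>A. P m a \<longrightarrow> a = m"
  proof (rule predicate_Zorn)
    show "partial_order_on A (relation_of P A)"
      by (rule partial_order_on_relation_ofI) (auto simp: P_def)
  next
    fix C assume C: "C \<in> Chains (relation_of P A)"
    have CA: "C \<subseteq> A" and chain: "\<And>a b. a \<in> C \<Longrightarrow> b \<in> C \<Longrightarrow> a \<le> b \<or> b \<le> a"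
      using C by (auto simp: Chains_def relation_of_def P_def)
    show "\<exists>u\<in>A. \<forall>a\<in>C. P a u"
    proof (cases "C = {}")
      case True
      then show ?thesis using g0 by (auto simp: A_def)
    next
      case False
      define u where "u = (\<lambda>x. INF g\<in>C. g x)"
      have bdd: "bdd_below ((\<lambda>g. g x) ` C)" for x
        using lower CA by (intro bdd_belowI[of _ "- g0 (- x)"]) auto
      have u_le: "u x \<le> g x" if "g \<in> C" for g x
        unfolding u_def by (rule cINF_lower[OF bdd that])
      have "convex_on UNIV u"
      proof (rule convex_onI)
        fix t :: real and x y assume t: "0 < t" "t < 1"
        show "u ((1 - t) *\<^sub>R x + t *\<^sub>R y) \<le> (1 - t) * u x + t * u y"
        proof (rule field_le_epsilon)
          fix e :: real assume e: "e > 0"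
          obtain a where a: "a \<in> C" "a x < u x + e"
            using cINF_less_iff[OF False bdd, of x "u x + e"] e by (auto simp: u_def)
          obtain b where b: "b \<in> C" "b y < u y + e"
            using cINF_less_iff[OF False bdd, of y "u y + e"] e by (auto simp: u_def)
          \<comment> \<open>An infimum of convex functions need not be convex. Here the chain
            property provides one member that is nearly optimal at \<open>x\<close> and at
            \<open>y\<close> simultaneously, and convexity of that member suffices.\<close>
          obtain c where c: "c \<in> C" "c \<le> a" "c \<le> b"
            using chain[OF a(1) b(1)] a(1) b(1) by auto
          have cx: "c x \<le> u x + e" and cy: "c y \<le> u y + e"
            using a(2) b(2) c(2,3) by (auto simp: le_fun_def intro: order.trans less_imp_le)
          have "u ((1 - t) *\<^sub>R x + t *\<^sub>R y) \<le> c ((1 - t) *\<^sub>R x + t *\<^sub>R y)"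
            by (rule u_le[OF c(1)])
          also have "\<dots> \<le> (1 - t) * c x + t * c y"
            using c(1) CA t by (intro convex_onD[of UNIV]) (auto simp: A_def)
          also have "\<dots> \<le> (1 - t) * (u x + e) + t * (u y + e)"
            using cx cy t by (intro add_mono mult_left_mono) auto
          finally show "u ((1 - t) *\<^sub>R x + t *\<^sub>R y) \<le> (1 - t) * u x + t * u y + e"
            by (simp add: algebra_simps)
        qed
      qed auto
      moreover have "u 0 = 0"
      proof -
        have "(\<lambda>g. g 0) ` C = {0}" using False CA by (auto simp: A_def)
        then show ?thesis by (simp add: u_def)
      qed
      moreover have "u \<le> g0"
      proof -
        obtain c where "c \<in> C" using False by blast
        then have "u \<le> c" "c \<le> g0" using u_le CA by (auto simp: A_def le_funI)
        then show ?thesis by (rule order.trans)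
      qed
      ultimately show ?thesis
        using u_le by (auto simp: A_def P_def le_fun_def)
    qed
  qed
  then obtain g where g: "g \<in> A" and min: "\<And>h. h \<in> A \<Longrightarrow> h \<le> g \<Longrightarrow> h = g"
    unfolding P_def by blast
  show thesis
  proof (rule that[of g])
    fix h assume "convex_on UNIV h" "h 0 = 0" "h \<le> g"
    then show "h = g"
      using g by (intro min) (auto simp: A_def)
  qed (use g in \<open>auto simp: A_def\<close>)
qed

text \<open>Minimality is tested against the rescalings \<open>g (c *\<^sub>R x) / c\<close> with
  \<open>0 < c \<le> 1\<close>, which gives positive homogeneity, and then against the translates
  \<open>g (x + y) - g y\<close>, which gives additivity. Both are convex, vanish at 0 and lie below
  \<open>g\<close>.\<close>

lemma convex_on_minimal_imp_linear:
  fixes g :: "'a::real_vector \<Rightarrow> real"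
  assumes conv: "convex_on UNIV g" and g0: "g 0 = 0"
    and min: "\<And>h. convex_on UNIV h \<Longrightarrow> h 0 = 0 \<Longrightarrow> h \<le> g \<Longrightarrow> h = g"
  shows "linear g"
proof -
  have shrink: "g (c *\<^sub>R x) = c * g x" if c: "0 < c" "c \<le> 1" for c x
  proof -
    let ?h = "\<lambda>x. g (c *\<^sub>R x) / c"
    have "convex_on UNIV ?h"
    proof (rule convex_onI)
      fix t :: real and x y assume t: "0 < t" "t < 1"
      have "g ((1 - t) *\<^sub>R (c *\<^sub>R x) + t *\<^sub>R (c *\<^sub>R y)) \<le> (1 - t) * g (c *\<^sub>R x) + t * g (c *\<^sub>R y)"
        using t by (intro convex_onD[OF conv]) auto
      then show "?h ((1 - t) *\<^sub>R x + t *\<^sub>R y) \<le> (1 - t) * ?h x + t * ?h y"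
        using c by (simp add: field_simps scaleR_add_right)
    qed auto
    moreover have "?h \<le> g"
    proof (rule le_funI)
      fix x
      have "g ((1 - c) *\<^sub>R 0 + c *\<^sub>R x) \<le> (1 - c) * g 0 + c * g x"
        using c by (intro convex_onD[OF conv]) auto
      then show "?h x \<le> g x" using c g0 by (simp add: field_simps)
    qed
    ultimately have "?h = g" using g0 by (intro min) auto
    then have "?h x = g x" by (rule fun_cong)
    then show ?thesis using c by (simp add: field_simps)
  qed
  have pos: "g (c *\<^sub>R x) = c * g x" if "0 < c" for c x
  proof (cases "c \<le> 1")
    case False
    \<comment> \<open>A factor above 1 is undone by shrinking \<open>c *\<^sub>R x\<close> back to
      \<open>x\<close>.\<close>
    then show ?thesis using shrink[of "inverse c" "c *\<^sub>R x"] that by (simp add: field_simps)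
  qed (use that shrink in auto)
  have subadd: "g (x + y) \<le> g x + g y" for x y
  proof -
    have "g ((1 - 1/2) *\<^sub>R (2 *\<^sub>R x) + (1/2) *\<^sub>R (2 *\<^sub>R y))
        \<le> (1 - 1/2) * g (2 *\<^sub>R x) + (1/2) * g (2 *\<^sub>R y)"
      by (intro convex_onD[OF conv]) auto
    then show ?thesis using pos[of 2 x] pos[of 2 y] by simp
  qed
  have add: "g (x + y) = g x + g y" for x y
  proof -
    let ?h = "\<lambda>x. g (x + y) - g y"
    have "convex_on UNIV ?h"
    proof (rule convex_onI)
      fix t :: real and a b assume t: "0 < t" "t < 1"
      have "g ((1 - t) *\<^sub>R (a + y) + t *\<^sub>R (b + y)) \<le> (1 - t) * g (a + y) + t * g (b + y)"
        using t by (intro convex_onD[OF conv]) auto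
      moreover have "(1 - t) *\<^sub>R (a + y) + t *\<^sub>R (b + y) = (1 - t) *\<^sub>R a + t *\<^sub>R b + y"
        by (simp add: algebra_simps)
      ultimately show "?h ((1 - t) *\<^sub>R a + t *\<^sub>R b) \<le> (1 - t) * ?h a + t * ?h b"
        by (simp add: algebra_simps)
    qed auto
    \<comment> \<open>That the translate lies below \<open>g\<close> is exactly
      subadditivity.\<close>
    moreover have "?h \<le> g" using subadd[of _ y] by (auto simp: le_fun_def algebra_simps)
    ultimately have "?h = g" by (intro min) auto
    then have "?h x = g x" by (rule fun_cong)
    then show ?thesis by simp
  qed
  have neg: "g (- x) = - g x" for x using add[of x "- x"] g0 by simp
  show ?thesis
  proof (rule linearI)
    fix c x
    show "g (c *\<^sub>R x) = c *\<^sub>R g x"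
      using pos[of c x] pos[of "- c" x] neg[of "c *\<^sub>R x"] g0
      by (cases "c = 0"; cases "c > 0") auto
  qed (rule add)
qed

lemma linear_bounded_above_near_0_imp_bounded_linear:
  fixes g :: "'a::real_normed_vector \<Rightarrow> real"
  assumes g: "linear g" and d: "d > 0" and le: "\<And>x. norm x \<le> d \<Longrightarrow> g x \<le> K"
  shows "bounded_linear g"
proof -
  have bound: "g x \<le> norm x * (K / d)" for x
  proof (cases "x = 0")
    case False
    have "g ((d / norm x) *\<^sub>R x) \<le> K" using d False by (intro le) auto
    then show ?thesis using d False by (simp add: linear_cmul[OF g] field_simps)
  qed (simp add: linear_0[OF g])
  show ?thesis
    unfolding bounded_linear_def bounded_linear_axioms_def
  proof (intro conjI exI allI)
    fix x show "norm (g x) \<le> norm x * (K / d)"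
      \<comment> \<open>Linearity makes the one-sided estimate at \<open>- x\<close> the missing
        lower estimate at \<open>x\<close>.\<close>
      using bound[of x] bound[of "- x"] by (simp add: linear_neg[OF g] abs_le_iff)
  qed (rule g)
qed

text \<open>A minimal convex minorant of the increment of \<open>f\<close> at \<open>y\<close> is
  linear. Continuity of \<open>f\<close> at \<open>y\<close> bounds the increment, hence the
  minorant, from above near 0, and this makes the linear functional bounded.\<close>

lemma convex_on_subgradient_exists:
  fixes f :: "'a::real_normed_vector \<Rightarrow> real"
  assumes cont: "continuous_on UNIV f" and conv: "convex_on UNIV f"
  obtains p :: "'a \<Rightarrow>\<^sub>L real" where "\<And>h. blinfun_apply p h \<le> f (y + h) - f y"
proof -
  let ?g = "\<lambda>h. f (y + h) - f y"
  have "convex_on UNIV ?g"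
  proof (rule convex_onI)
    fix t :: real and a b assume t: "0 < t" "t < 1"
    have "f ((1 - t) *\<^sub>R (y + a) + t *\<^sub>R (y + b)) \<le> (1 - t) * f (y + a) + t * f (y + b)"
      using t by (intro convex_onD[OF conv]) auto
    moreover have "(1 - t) *\<^sub>R (y + a) + t *\<^sub>R (y + b) = y + ((1 - t) *\<^sub>R a + t *\<^sub>R b)"
      by (simp add: algebra_simps)
    ultimately show "?g ((1 - t) *\<^sub>R a + t *\<^sub>R b) \<le> (1 - t) * ?g a + t * ?g b"
      by (simp add: algebra_simps)
  qed auto
  then obtain p where p: "convex_on UNIV p" "p 0 = 0" "p \<le> ?g"
    "\<And>h. convex_on UNIV h \<Longrightarrow> h 0 = 0 \<Longrightarrow> h \<le> p \<Longrightarrow> h = p"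
    using convex_on_minimal_minorant[of ?g] by auto
  have lin: "linear p" by (rule convex_on_minimal_imp_linear[OF p(1,2,4)])
  obtain d where d: "d > 0" "\<And>z. dist z y < d \<Longrightarrow> dist (f z) (f y) < 1"
    using cont unfolding continuous_on_iff by (metis UNIV_I zero_less_one)
  have "bounded_linear p"
  proof (rule linear_bounded_above_near_0_imp_bounded_linear[OF lin])
    \<comment> \<open>The radius is halved because continuity controls \<open>f\<close> only on the
      open ball of radius \<open>d\<close>.\<close>
    fix h :: 'a assume "norm h \<le> d / 2"
    then have "dist (f (y + h)) (f y) < 1" using d by (intro d(2)) (simp add: dist_norm)
    moreover have "p h \<le> ?g h" using p(3) by (rule le_funD)
    ultimately show "p h \<le> 1" by (simp add: dist_real_def)
  qed (use d in auto)
  then show thesis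
    using p(3) by (intro that[of "Blinfun p"]) (auto simp: bounded_linear_Blinfun_apply le_fun_def)
qed

section \<open>The Gateaux derivative and weak-star convergence of nearby subgradients\<close>

lemma gateaux_derivative_tendsto:
  assumes "has_beta_derivative {A. finite A \<and> A \<noteq> {}} f D x"
  shows "((\<lambda>t. (f (x + t *\<^sub>R h) - f x) / t) \<longlongrightarrow> blinfun_apply D h) (at 0)"
proof -
  have "((\<lambda>t. SUP u\<in>{h}. ennreal \<bar>(f (x + t *\<^sub>R u) - f x) / t - blinfun_apply D u\<bar>) \<longlongrightarrow> 0) (at 0)"
    using assms unfolding has_beta_derivative_def by blast
  then have "((\<lambda>t. ennreal \<bar>(f (x + t *\<^sub>R h) - f x) / t - blinfun_apply D h\<bar>) \<longlongrightarrow> ennreal 0) (at 0)"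
    by simp
  then have "((\<lambda>t. \<bar>(f (x + t *\<^sub>R h) - f x) / t - blinfun_apply D h\<bar>) \<longlongrightarrow> 0) (at 0)"
    by (subst (asm) tendsto_ennreal_iff) auto
  then show ?thesis
    by (simp add: tendsto_rabs_zero_iff Lim_null[symmetric] LIM_zero_iff)
qed

text \<open>By convexity, the difference quotients with \<open>0 < t < 1\<close> are at most the one
  with \<open>t = 1\<close>. The bound survives the limit from the right.\<close>

lemma gateaux_derivative_is_subgradient:
  fixes f :: "'a::real_normed_vector \<Rightarrow> real"
  assumes conv: "convex_on UNIV f"
    and D: "((\<lambda>t. (f (x + t *\<^sub>R h) - f x) / t) \<longlongrightarrow> d) (at 0)"
  shows "d \<le> f (x + h) - f x"
proof (rule tendsto_upperbound)
  show "((\<lambda>t. (f (x + t *\<^sub>R h) - f x) / t) \<longlongrightarrow> d) (at_right 0)"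
    using D by (rule filterlim_mono) (auto simp: at_le)
  have "(f (x + t *\<^sub>R h) - f x) / t \<le> f (x + h) - f x" if t: "0 < t" "t < 1" for t
  proof -
    have "f ((1 - t) *\<^sub>R x + t *\<^sub>R (x + h)) \<le> (1 - t) * f x + t * f (x + h)"
      using t by (intro convex_onD[OF conv]) auto
    then show ?thesis using t by (simp add: field_simps)
  qed
  then show "\<forall>\<^sub>F t in at_right 0. (f (x + t *\<^sub>R h) - f x) / t \<le> f (x + h) - f x"
    by (auto simp: eventually_at_right_field intro!: exI[of _ 1])
qed simp

text \<open>Fix one step \<open>s > 0\<close> whose difference quotient at \<open>x\<close> is below
  \<open>d + e\<close>. Continuity of \<open>f\<close> carries this strict bound over to the base
  points \<open>X n\<close> for large \<open>n\<close>, and the subgradient inequality in direction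
  \<open>s *\<^sub>R h\<close> bounds \<open>p n\<close> at \<open>h\<close> by the quotient
  there.\<close>

lemma subgradients_upper_bound:
  fixes f :: "'a::real_normed_vector \<Rightarrow> real"
  assumes cont: "continuous_on UNIV f"
    and D: "((\<lambda>t. (f (x + t *\<^sub>R h) - f x) / t) \<longlongrightarrow> d) (at 0)"
    and X: "X \<longlonglongrightarrow> x"
    and p: "\<And>n h. blinfun_apply (p n) h \<le> f (X n + h) - f (X n)"
    and e: "e > 0"
  shows "\<forall>\<^sub>F n in sequentially. blinfun_apply (p n) h < d + e"
proof -
  have "\<forall>\<^sub>F t in at_right 0. (f (x + t *\<^sub>R h) - f x) / t < d + e"
    using order_tendstoD(2)[OF D, of "d + e"] e
    by (auto intro: filter_leD[OF at_le, rotated])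
  then have "\<forall>\<^sub>F t in at_right 0. 0 < t \<and> (f (x + t *\<^sub>R h) - f x) / t < d + e"
    by (intro eventually_conj eventually_at_right_less)
  then obtain s where s: "0 < s" "(f (x + s *\<^sub>R h) - f x) / s < d + e"
    using eventually_happens' trivial_limit_at_right_real by blast
  have "(\<lambda>n. (f (X n + s *\<^sub>R h) - f (X n)) / s) \<longlonglongrightarrow> (f (x + s *\<^sub>R h) - f x) / s"
    using s(1) by (intro tendsto_intros continuous_on_tendsto_compose[OF cont] X) auto
  then have "\<forall>\<^sub>F n in sequentially. (f (X n + s *\<^sub>R h) - f (X n)) / s < d + e"
    using s(2) by (rule order_tendstoD(2))
  then show ?thesis
  proof eventually_elim
    case (elim n)
    have "s * blinfun_apply (p n) h \<le> f (X n + s *\<^sub>R h) - f (X n)"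
      using p[of n "s *\<^sub>R h"] by (simp add: blinfun.scaleR_right)
    then have "blinfun_apply (p n) h \<le> (f (X n + s *\<^sub>R h) - f (X n)) / s"
      using s(1) by (simp add: field_simps)
    then show ?case using elim by simp
  qed
qed

lemma subgradients_weak_star_tendsto:
  fixes f :: "'a::real_normed_vector \<Rightarrow> real"
  assumes cont: "continuous_on UNIV f"
    and D: "\<And>h. ((\<lambda>t. (f (x + t *\<^sub>R h) - f x) / t) \<longlongrightarrow> blinfun_apply D h) (at 0)"
    and X: "X \<longlonglongrightarrow> x"
    and p: "\<And>n h. blinfun_apply (p n) h \<le> f (X n + h) - f (X n)"
  shows "weak_star_null (\<lambda>n. p n - D)"
  unfolding weak_star_null_def
proof
  fix h
  \<comment> \<open>The upper bound in direction \<open>- h\<close> is a lower bound in direction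
    \<open>h\<close>, since \<open>p n\<close> and \<open>D\<close> are linear.\<close>
  have "\<forall>\<^sub>F n in sequentially. \<bar>blinfun_apply (p n - D) h\<bar> < e" if "e > 0" for e
    using subgradients_upper_bound[OF cont D[of h] X p that]
      subgradients_upper_bound[OF cont D[of "- h"] X p that]
    by eventually_elim (auto simp: blinfun.diff_left blinfun.minus_right)
  then show "(\<lambda>n. blinfun_apply (p n - D) h) \<longlonglongrightarrow> 0"
    by (auto simp: tendsto_iff dist_real_def)
qed

section \<open>From finite sets to limited sets\<close>

lemma finite_imp_limited:
  assumes A: "finite A"
  shows "limited A"
  unfolding limited_def
proof (intro conjI allI impI)
  fix \<phi> :: "nat \<Rightarrow> ('a \<Rightarrow>\<^sub>L real)"
  assume "weak_star_null \<phi>"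
  then have lim: "(\<lambda>n. ennreal \<bar>blinfun_apply (\<phi> n) x\<bar>) \<longlonglongrightarrow> 0" for x
    unfolding weak_star_null_def ennreal_0[symmetric]
    by (intro tendsto_ennrealI tendsto_rabs_zero) auto
  show "(\<lambda>n. SUP x\<in>A. ennreal \<bar>blinfun_apply (\<phi> n) x\<bar>) \<longlonglongrightarrow> 0"
  proof (rule order_tendstoI)
    fix a :: ennreal assume a: "0 < a"
    have "\<forall>\<^sub>F n in sequentially. \<forall>x\<in>A. ennreal \<bar>blinfun_apply (\<phi> n) x\<bar> < a"
      using A order_tendstoD(2)[OF lim a] by (intro eventually_ball_finite) auto
    then show "\<forall>\<^sub>F n in sequentially. (SUP x\<in>A. ennreal \<bar>blinfun_apply (\<phi> n) x\<bar>) < a"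
    proof eventually_elim
      case (elim n)
      then show ?case
        \<comment> \<open>For empty \<open>A\<close> the supremum is \<open>bot\<close>, which is
          below the positive \<open>a\<close>.\<close>
        using A a by (cases "A = {}") (auto simp: bot_ennreal intro!: finite_imp_Sup_less)
    qed
  qed auto
qed (use A in auto)

text \<open>Here \<open>w\<close> stands for an increment of \<open>f\<close> along
  \<open>t *\<^sub>R u\<close>, while \<open>p\<close> and \<open>d\<close> are the values at
  \<open>u\<close> of a subgradient at the far endpoint and of the derivative at the base point. The
  quotient \<open>w / t\<close> lies between \<open>d\<close> and \<open>p\<close>, in an order set
  by the sign of \<open>t\<close>.\<close>

lemma abs_quotient_minus_le:
  fixes t :: real
  assumes "t \<noteq> 0" "w \<le> t * p" "t * d \<le> w"
  shows "\<bar>w / t - d\<bar> \<le> \<bar>p - d\<bar>"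
proof (cases "t > 0")
  case True
  then have "d \<le> w / t" "w / t \<le> p" using assms by (simp_all add: field_simps)
  then show ?thesis by simp
next
  case False
  then have "w / t \<le> d" "p \<le> w / t" using assms by (simp_all add: field_simps)
  then show ?thesis by simp
qed

lemma gateaux_derivative_imp_limited_derivative:
  fixes f :: "'a::real_normed_vector \<Rightarrow> real"
  assumes cont: "continuous_on UNIV f" and conv: "convex_on UNIV f"
    and G: "has_beta_derivative {A. finite A \<and> A \<noteq> {}} f D x"
  shows "has_beta_derivative {A. limited A \<and> A \<noteq> {}} f D x"
  unfolding has_beta_derivative_def
proof
  fix A :: "'a set" assume "A \<in> {A. limited A \<and> A \<noteq> {}}"
  then have A: "limited A" "A \<noteq> {}" by auto
  note D = gateaux_derivative_tendsto[OF G]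
  define q where "q = (\<lambda>t u. \<bar>(f (x + t *\<^sub>R u) - f x) / t - blinfun_apply D u\<bar>)"
  have "((\<lambda>t. SUP u\<in>A. ennreal (q t u)) \<longlongrightarrow> 0) (at 0)"
    \<comment> \<open>Limitedness speaks of sequences of functionals, so the limit in
      \<open>t\<close> is tested along sequences.\<close>
    unfolding tendsto_at_iff_sequentially comp_def
  proof (intro allI impI)
    fix T :: "nat \<Rightarrow> real"
    assume T0: "\<forall>i. T i \<in> UNIV - {0}" and T: "T \<longlonglongrightarrow> 0"
    show "(\<lambda>n. SUP u\<in>A. ennreal (q (T n) u)) \<longlonglongrightarrow> 0"
    proof (rule order_tendstoI)
      fix \<epsilon> :: ennreal assume "0 < \<epsilon>"
      then obtain e where e: "0 < e" "e < \<epsilon>" using dense by blast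
      \<comment> \<open>The supremum may not be attained, so the witness only has to exceed the
        smaller \<open>e\<close>. The implication lets \<open>u n\<close> be some point of the
        nonempty \<open>A\<close> for every \<open>n\<close>, also where the supremum is already
        small.\<close>
      have "\<exists>u\<in>A. \<epsilon> \<le> (SUP u\<in>A. ennreal (q (T n) u)) \<longrightarrow> e < ennreal (q (T n) u)" for n
        using A(2) e(2) less_SUP_iff[of e "\<lambda>u. ennreal (q (T n) u)" A]
        by (meson ex_in_conv less_le_trans)
      then obtain u where u: "\<And>n. u n \<in> A"
        "\<And>n. \<epsilon> \<le> (SUP u\<in>A. ennreal (q (T n) u)) \<Longrightarrow> e < ennreal (q (T n) (u n))"
        by metis
      define X where "X = (\<lambda>n. x + T n *\<^sub>R u n)"
      obtain B where B: "\<And>a. a \<in> A \<Longrightarrow> norm a \<le> B"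
        using A(1) by (auto simp: limited_def bounded_iff)
      have "(\<lambda>n. T n *\<^sub>R u n) \<longlonglongrightarrow> 0"
      proof (rule Lim_null_comparison)
        show "\<forall>\<^sub>F n in sequentially. norm (T n *\<^sub>R u n) \<le> \<bar>T n\<bar> * B"
          using B[OF u(1)] by (intro always_eventually) (simp add: mult_left_mono)
        show "(\<lambda>n. \<bar>T n\<bar> * B) \<longlonglongrightarrow> 0"
          by (rule tendsto_mult_left_zero[OF tendsto_rabs_zero[OF T]])
      qed
      then have X: "X \<longlonglongrightarrow> x"
        unfolding X_def using tendsto_add[OF tendsto_const, of _ 0 _ x] by simp
      have "\<exists>p :: 'a \<Rightarrow>\<^sub>L real. \<forall>h. blinfun_apply p h \<le> f (X n + h) - f (X n)" for n
        using convex_on_subgradient_exists[OF cont conv, of "X n"] by metis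
      then obtain p :: "nat \<Rightarrow> 'a \<Rightarrow>\<^sub>L real"
        where p: "\<And>n h. blinfun_apply (p n) h \<le> f (X n + h) - f (X n)"
        by metis
      have q_le: "q (T n) (u n) \<le> \<bar>blinfun_apply (p n - D) (u n)\<bar>" for n
      proof -
        have t: "T n \<noteq> 0" using T0 by auto
        \<comment> \<open>The subgradient at \<open>X n\<close> is tested in the direction leading
          back to \<open>x\<close>; this bounds the increment from above, and the derivative at
          \<open>x\<close> bounds it from below.\<close>
        have "blinfun_apply (p n) (- T n *\<^sub>R u n) \<le> f (X n + - T n *\<^sub>R u n) - f (X n)"
          by (rule p)
        then have "f (x + T n *\<^sub>R u n) - f x \<le> T n * blinfun_apply (p n) (u n)"
          by (simp add: X_def blinfun.scaleR_right blinfun.minus_right)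
        moreover have "T n * blinfun_apply D (u n) \<le> f (x + T n *\<^sub>R u n) - f x"
          using gateaux_derivative_is_subgradient[OF conv D[of "T n *\<^sub>R u n"]]
          by (simp add: blinfun.scaleR_right)
        ultimately show ?thesis
          unfolding q_def blinfun.diff_left by (intro abs_quotient_minus_le t)
      qed
      have "(\<lambda>n. SUP a\<in>A. ennreal \<bar>blinfun_apply (p n - D) a\<bar>) \<longlonglongrightarrow> 0"
        using A(1) subgradients_weak_star_tendsto[OF cont D X p] unfolding limited_def by blast
      then have "\<forall>\<^sub>F n in sequentially. (SUP a\<in>A. ennreal \<bar>blinfun_apply (p n - D) a\<bar>) < e"
        using e(1) by (rule order_tendstoD(2))
      then show "\<forall>\<^sub>F n in sequentially. (SUP u\<in>A. ennreal (q (T n) u)) < \<epsilon>"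
      proof eventually_elim
        case (elim n)
        have "ennreal (q (T n) (u n)) \<le> ennreal \<bar>blinfun_apply (p n - D) (u n)\<bar>"
          by (intro ennreal_leI q_le)
        also have "\<dots> \<le> (SUP a\<in>A. ennreal \<bar>blinfun_apply (p n - D) a\<bar>)"
          by (rule SUP_upper[OF u(1)])
        finally have "ennreal (q (T n) (u n)) < e" using elim by simp
        \<comment> \<open>A supremum of at least \<open>\<epsilon>\<close> would force the error at
          \<open>u n\<close> above \<open>e\<close>.\<close>
        then show ?case using u(2)[of n] by (meson not_le less_asym)
      qed
    qed auto
  qed
  then show "((\<lambda>t. SUP u\<in>A. ennreal \<bar>(f (x + t *\<^sub>R u) - f x) / t - blinfun_apply D u\<bar>) \<longlongrightarrow> 0) (at 0)"
    by (simp add: q_def)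
qed

theorem proposition5p3:
  fixes f :: "'a::banach \<Rightarrow> real" and x :: 'a
  assumes "continuous_on UNIV f"
    and "convex_on UNIV f"
  shows "gateaux_differentiable f x \<longleftrightarrow> limited_differentiable f x"
proof
  assume "gateaux_differentiable f x"
  then show "limited_differentiable f x"
    using gateaux_derivative_imp_limited_derivative[OF assms]
    unfolding gateaux_differentiable_def limited_differentiable_def beta_differentiable_def by blast
next
  assume "limited_differentiable f x"
  \<comment> \<open>Finite sets are limited, so the same functional serves the smaller
    family.\<close>
  then show "gateaux_differentiable f x"
    using finite_imp_limited
    unfolding gateaux_differentiable_def limited_differentiable_def beta_differentiable_def
      has_beta_derivative_def by blast
qed

end
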